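(* Let $X$, $Y$, and $Z$ be normed spaces, $T\in LR(X,Y)$, and $S\in LR(X,Z)$ with $D(T)\subset D(S)$. If $S$ is bounded, then $S$ is $T$-bounded with $T$-bound $0$.
   Context: All spaces are over the same scalar field ($\mathbf R$ or $\mathbf C$). $LR(X,Y)$ is the set of all linear subspaces of $X\times Y$. For $T\in LR(X,Y)$: $D(T)$ is its domain, $T(x)=\{y\in Y:(x,y)\in T\}$. For $x\in D(T)$, $\|T(x)\|:=\|[y]\|$ for any $y\in T(x)$, where $[y]=y+\overline{T(0)}\in Y/\overline{T(0)}$ and $\|[y]\|=\inf\{\|y-e\|:e\in\overline{T(0)}\}$. $\|T\|:=\sup\{\|T(x)\|:x\in D(T),\ \|x\|\le1\}$, and $T$ is bounded if $\|T\|<\infty$ (likewise for $S$). $S$ is $T$-bounded if $D(T)\subset D(S)$ and there is $c\ge0$ with $\|S(x)\|\le c(\|x\|+\|T(x)\|)$ for all $x\in D(T)$. If $S$ is $T$-bounded, the $T$-bound of $S$ is the infimum of all $b\ge0$ for which there is $a\ge0$ with $\|S(x)\|\le a\|x\|+b\|T(x)\|$ for all $x\in D(T)$. *)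

theory Defs
  imports "HOL-Analysis.Analysis"
begin

(* The scalar field is a type 'k :: real_normed_field.  Its norm is multiplicative and it is a
   commutative unital real algebra, so by Gelfand-Mazur such a field is isometrically isomorphic to
   the reals or to the complex numbers: the class covers exactly the two classical cases (with
   instances real and complex), which can then be treated by one statement.
   The library has no complex normed spaces.  A normed space over 'k is therefore a real normed
   vector space with a scalar multiplication over 'k for which the norm is homogeneous; scale_of_real
   says that the real structure of the type is the restriction of scalars. *)

locale normed_vector_space = vector_space scale
  for scale :: "'k::real_normed_field \<Rightarrow> 'x::real_normed_vector \<Rightarrow> 'x" +
  assumes norm_scale: "norm (scale a x) = norm a * norm x"
    and scale_of_real: "scale (of_real r) x = r *\<^sub>R x"

lemma normed_vector_space_scaleR:
  "normed_vector_space (scaleR :: real \<Rightarrow> 'x::real_normed_vector \<Rightarrow> 'x)"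
  by unfold_locales (simp_all add: algebra_simps)

lemma normed_vector_space_times:
  "normed_vector_space ((*) :: complex \<Rightarrow> complex \<Rightarrow> complex)"
  by unfold_locales (simp_all add: algebra_simps norm_mult scaleR_conv_of_real)

(* A relation T has domain D(T) = Domain T and values T(x) = T `` {x}. *)
definition LR ::
  "('k::real_normed_field \<Rightarrow> 'x::real_normed_vector \<Rightarrow> 'x) \<Rightarrow>
   ('k \<Rightarrow> 'y::real_normed_vector \<Rightarrow> 'y) \<Rightarrow> ('x \<times> 'y) set set" where
  "LR sX sY = {T. module.subspace (module_prod.scale sX sY) T}"

(* Norm of the class [y] in the quotient of the space by E. *)
definition quotient_norm :: "'y::real_normed_vector set \<Rightarrow> 'y \<Rightarrow> real" where
  "quotient_norm E y = Inf {norm (y - e) | e. e \<in> E}"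

(* The norm of T(x); for x in the domain of a linear relation the choice of y is immaterial, see
   value_norm_eq. *)
definition value_norm ::
  "('x::real_normed_vector \<times> 'y::real_normed_vector) set \<Rightarrow> 'x \<Rightarrow> real" where
  "value_norm T x = quotient_norm (closure (T `` {0})) (SOME y. y \<in> T `` {x})"

definition rel_norm :: "('x::real_normed_vector \<times> 'y::real_normed_vector) set \<Rightarrow> ereal" where
  "rel_norm T = (SUP x \<in> {x \<in> Domain T. norm x \<le> 1}. ereal (value_norm T x))"

definition rel_bounded :: "('x::real_normed_vector \<times> 'y::real_normed_vector) set \<Rightarrow> bool" where
  "rel_bounded T \<longleftrightarrow> rel_norm T < \<infinity>"

(* relatively_bounded T S: S is T-bounded. *)
definition relatively_bounded ::
  "('x::real_normed_vector \<times> 'y::real_normed_vector) set \<Rightarrow>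
   ('x \<times> 'z::real_normed_vector) set \<Rightarrow> bool" where
  "relatively_bounded T S \<longleftrightarrow> Domain T \<subseteq> Domain S \<and>
     (\<exists>c\<ge>0. \<forall>x\<in>Domain T. value_norm S x \<le> c * (norm x + value_norm T x))"

(* Meaningful only if S is T-bounded: otherwise the set below may be empty. *)
definition relative_bound ::
  "('x::real_normed_vector \<times> 'y::real_normed_vector) set \<Rightarrow>
   ('x \<times> 'z::real_normed_vector) set \<Rightarrow> real" where
  "relative_bound T S =
     Inf {b. 0 \<le> b \<and>
            (\<exists>a\<ge>0. \<forall>x\<in>Domain T. value_norm S x \<le> a * norm x + b * value_norm T x)}"

lemma value_norm_eq:
  assumes X: "normed_vector_space sX" and Y: "normed_vector_space sY"
    and T: "T \<in> LR sX sY" and y: "(x, y) \<in> T"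
  shows "value_norm T x = quotient_norm (closure (T `` {0})) y"
proof -
  interpret X: normed_vector_space sX by (fact X)
  interpret Y: normed_vector_space sY by (fact Y)
  interpret vector_space_prod sX sY ..
  have sub: "p.subspace T" using T by (simp add: LR_def)
  define y' where "y' = (SOME y. y \<in> T `` {x})"
  define E where "E = closure (T `` {0})"
  define d where "d = y - y'"
  have y': "(x, y') \<in> T"
    using someI[of "\<lambda>y. y \<in> T `` {x}" y] y by (simp add: y'_def)
  have "(x, y) - (x, y') \<in> T" using sub y y' by (rule p.subspace_diff)
  then have d: "(0, d) \<in> T" by (simp add: d_def)
  have "(\<lambda>e. d + e) ` (T `` {0}) = T `` {0}"
  proof (intro equalityI subsetI)
    fix e assume "e \<in> (\<lambda>e. d + e) ` (T `` {0})"
    then show "e \<in> T `` {0}" using p.subspace_add[OF sub d] by auto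
  next
    fix e assume "e \<in> T `` {0}"
    then have "e - d \<in> T `` {0}" using p.subspace_diff[OF sub _ d, of "(0, e)"] by simp
    then show "e \<in> (\<lambda>e. d + e) ` (T `` {0})" by (rule rev_image_eqI) simp
  qed
  then have E: "(\<lambda>e. d + e) ` E = E"
    unfolding E_def by (metis closure_translation)
  have "{norm (y - e) | e. e \<in> E} = (\<lambda>e. norm (y - e)) ` ((\<lambda>e. d + e) ` E)"
    unfolding E by auto
  also have "\<dots> = {norm (y' - e) | e. e \<in> E}"
    unfolding image_image d_def by (auto simp: algebra_simps)
  finally show ?thesis
    by (simp add: value_norm_def quotient_norm_def E_def y'_def)
qed

end

theory Submission
  imports Defs
begin

text \<open>The function \<open>x \<mapsto> \<parallel>S(x)\<parallel>\<close> is positively homogeneous on \<open>D(S)\<close>, so normalising \<open>x\<close> turns the bound of \<open>S\<close> on the unit ball into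
  \<open>\<parallel>S(x)\<parallel> \<le> M \<parallel>x\<parallel>\<close> on all of \<open>D(S)\<close> (lemma \<open>value_norm_le_of_rel_bounded\<close>). Since
  \<open>\<parallel>T(x)\<parallel> \<ge> 0\<close>, this estimate gives \<open>T\<close>-boundedness with \<open>c = M\<close>; and it is itself a relative
  bound with coefficient \<open>b = 0\<close>, the least value admitted in the infimum.\<close>

lemma quotient_norm_le:
  assumes "e \<in> E"
  shows "quotient_norm E y \<le> norm (y - e)"
  unfolding quotient_norm_def using assms by (auto intro!: cInf_lower bdd_belowI[of _ 0])

lemma quotient_norm_greatest:
  assumes "E \<noteq> {}" and "\<And>e. e \<in> E \<Longrightarrow> b \<le> norm (y - e)"
  shows "b \<le> quotient_norm E y"
  unfolding quotient_norm_def using assms by (auto intro!: cInf_greatest)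

lemma quotient_norm_scaleR_le:
  assumes E: "subspace E" and r: "0 < r"
  shows "quotient_norm E (r *\<^sub>R y) \<le> r * quotient_norm E y"
proof -
  have "quotient_norm E (r *\<^sub>R y) / r \<le> quotient_norm E y"
  proof (rule quotient_norm_greatest)
    show "E \<noteq> {}" using subspace_0[OF E] by blast
  next
    fix e assume "e \<in> E"
    then have "quotient_norm E (r *\<^sub>R y) \<le> norm (r *\<^sub>R y - r *\<^sub>R e)"
      by (intro quotient_norm_le subspace_scale[OF E])
    also have "\<dots> = r * norm (y - e)"
      using r by (simp flip: scaleR_diff_right)
    finally show "quotient_norm E (r *\<^sub>R y) / r \<le> norm (y - e)"
      using r by (simp add: field_simps)
  qed
  then show ?thesis using r by (simp add: field_simps)
qed

text \<open>Normalising a vector only involves real factors, so every homogeneity argument below can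
  be carried out after restriction of scalars to the reals.\<close>

lemma LR_real_subspace:
  assumes X: "normed_vector_space sX" and Y: "normed_vector_space sY"
    and T: "T \<in> LR sX sY"
  shows "subspace T"
proof -
  interpret X: normed_vector_space sX by (fact X)
  interpret Y: normed_vector_space sY by (fact Y)
  interpret vector_space_prod sX sY ..
  have sub: "p.subspace T" using T by (simp add: LR_def)
  show ?thesis
  proof (rule subspaceI)
    show "0 \<in> T" by (rule p.subspace_0[OF sub])
  next
    fix u v assume "u \<in> T" "v \<in> T"
    then show "u + v \<in> T" by (rule p.subspace_add[OF sub])
  next
    fix c u assume "u \<in> T"
    then have "scale (of_real c) u \<in> T" by (rule p.subspace_scale[OF sub])
    then show "c *\<^sub>R u \<in> T"
      by (cases u) (simp add: scale_def X.scale_of_real Y.scale_of_real)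
  qed
qed

lemma subspace_closure:
  fixes V :: "'a::real_normed_vector set"
  assumes V: "subspace V"
  shows "subspace (closure V)"
proof (rule subspaceI)
  show "0 \<in> closure V" using subspace_0[OF V] closure_subset by blast
next
  fix x y assume "x \<in> closure V" "y \<in> closure V"
  then obtain f g where f: "\<forall>n. f n \<in> V" "f \<longlonglongrightarrow> x" and g: "\<forall>n. g n \<in> V" "g \<longlonglongrightarrow> y"
    by (auto simp: closure_sequential)
  have "(\<lambda>n. f n + g n) \<longlonglongrightarrow> x + y" using f(2) g(2) by (rule tendsto_add)
  then show "x + y \<in> closure V"
    unfolding closure_sequential using subspace_add[OF V] f(1) g(1)
    by (intro exI[of _ "\<lambda>n. f n + g n"]) simp
next
  fix c x assume "x \<in> closure V"
  then obtain f where f: "\<forall>n. f n \<in> V" "f \<longlonglongrightarrow> x"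
    by (auto simp: closure_sequential)
  have "(\<lambda>n. c *\<^sub>R f n) \<longlonglongrightarrow> c *\<^sub>R x" using f(2) by (intro tendsto_intros)
  then show "c *\<^sub>R x \<in> closure V"
    unfolding closure_sequential using subspace_scale[OF V] f(1)
    by (intro exI[of _ "\<lambda>n. c *\<^sub>R f n"]) simp
qed

lemma subspace_closure_Image_0:
  fixes T :: "('x::real_normed_vector \<times> 'y::real_normed_vector) set"
  assumes "subspace T"
  shows "subspace (closure (T `` {0}))"
proof (rule subspace_closure[OF subspaceI])
  show "0 \<in> T `` {0}" using subspace_0[OF assms] by (simp add: zero_prod_def)
next
  fix y z assume "y \<in> T `` {0}" "z \<in> T `` {0}"
  then show "y + z \<in> T `` {0}" using subspace_add[OF assms, of "(0, y)" "(0, z)"] by simp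
next
  fix c y assume "y \<in> T `` {0}"
  then show "c *\<^sub>R y \<in> T `` {0}" using subspace_scale[OF assms, of "(0, y)" c] by simp
qed

lemma value_norm_nonneg:
  assumes "subspace T"
  shows "0 \<le> value_norm T x"
  unfolding value_norm_def
  using subspace_0[OF subspace_closure_Image_0[OF assms]]
  by (intro quotient_norm_greatest) auto

text \<open>Boundedness on the unit ball propagates by homogeneity. The vector \<open>x = 0\<close> cannot be
  normalised; there \<open>S(0)\<close> is the zero class of the quotient.\<close>

lemma value_norm_le_of_rel_bounded:
  assumes X: "normed_vector_space sX" and Z: "normed_vector_space sZ"
    and S: "S \<in> LR sX sZ" and bounded: "rel_bounded S"
  obtains M where "0 \<le> M" and "\<And>x. x \<in> Domain S \<Longrightarrow> value_norm S x \<le> M * norm x"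
proof -
  have sub: "subspace S" using X Z S by (rule LR_real_subspace)
  define E where "E = closure (S `` {0})"
  have E: "subspace E" unfolding E_def using sub by (rule subspace_closure_Image_0)
  have value_eq: "value_norm S x = quotient_norm E z" if "(x, z) \<in> S" for x z
    unfolding E_def using X Z S that by (rule value_norm_eq)
  have zero: "(0, 0) \<in> S" using subspace_0[OF sub] by (simp add: zero_prod_def)
  have ball: "ereal (value_norm S x) \<le> rel_norm S" if "x \<in> Domain S" "norm x \<le> 1" for x
    unfolding rel_norm_def using that by (intro SUP_upper) simp
  have "0 \<le> ereal (value_norm S 0)" using value_norm_nonneg[OF sub] by simp
  also have "\<dots> \<le> rel_norm S" using zero by (intro ball) auto
  finally obtain M where M: "rel_norm S = ereal M" "0 \<le> M"
    using bounded unfolding rel_bounded_def by (cases "rel_norm S") auto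
  have "value_norm S x \<le> M * norm x" if x: "x \<in> Domain S" for x
  proof (cases "x = 0")
    case True
    have "value_norm S 0 = quotient_norm E 0" using zero by (rule value_eq)
    also have "\<dots> \<le> 0" using quotient_norm_le[OF subspace_0[OF E], of 0] by simp
    finally show ?thesis using True by simp
  next
    case False
    from x obtain z where z: "(x, z) \<in> S" by blast
    define u where "u = x /\<^sub>R norm x"
    define w where "w = z /\<^sub>R norm x"
    have uw: "(u, w) \<in> S"
      using subspace_scale[OF sub z, of "inverse (norm x)"] by (simp add: u_def w_def)
    have "value_norm S x = quotient_norm E (norm x *\<^sub>R w)"
      using value_eq[OF z] False by (simp add: w_def)
    also have "\<dots> \<le> norm x * quotient_norm E w"
      using False by (intro quotient_norm_scaleR_le[OF E]) simp
    also have "\<dots> = norm x * value_norm S u" using value_eq[OF uw] by simp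
    also have "\<dots> \<le> norm x * M"
      using ball[of u] uw M False by (intro mult_left_mono) (auto simp: u_def)
    finally show ?thesis by (simp add: mult.commute)
  qed
  with M(2) show ?thesis by (rule that)
qed

theorem theorem6p1:
  fixes sX :: "'k::real_normed_field \<Rightarrow> 'x::real_normed_vector \<Rightarrow> 'x"
    and sY :: "'k \<Rightarrow> 'y::real_normed_vector \<Rightarrow> 'y"
    and sZ :: "'k \<Rightarrow> 'z::real_normed_vector \<Rightarrow> 'z"
    and T :: "('x \<times> 'y) set"
    and S :: "('x \<times> 'z) set"
  assumes "normed_vector_space sX"
    and "normed_vector_space sY"
    and "normed_vector_space sZ"
    and "T \<in> LR sX sY"
    and "S \<in> LR sX sZ"
    and "Domain T \<subseteq> Domain S"
    and "rel_bounded S"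
  shows "relatively_bounded T S \<and> relative_bound T S = 0"
proof -
  obtain M where M: "0 \<le> M" "\<And>x. x \<in> Domain S \<Longrightarrow> value_norm S x \<le> M * norm x"
    using value_norm_le_of_rel_bounded[OF assms(1,3,5,7)] by blast
  have S_le: "value_norm S x \<le> M * norm x" if "x \<in> Domain T" for x
    using M(2) that assms(6) by blast
  have "value_norm S x \<le> M * (norm x + value_norm T x)" if "x \<in> Domain T" for x
  proof -
    have "0 \<le> value_norm T x"
      using LR_real_subspace[OF assms(1,2,4)] by (rule value_norm_nonneg)
    then have "M * norm x \<le> M * (norm x + value_norm T x)"
      using M(1) by (intro mult_left_mono) auto
    with S_le[OF that] show ?thesis by linarith
  qed
  then have "relatively_bounded T S"
    unfolding relatively_bounded_def using assms(6) M(1) by blast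
  moreover have "relative_bound T S = 0"
    unfolding relative_bound_def using M(1) S_le by (intro cInf_eq_minimum) auto
  ultimately show ?thesis ..
qed

end
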